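(* Let $n\ge 1$ be an integer, $\lambda_0>0$, and $d>0$ arbitrary. Let $F_0(s)$ be the $n\times n$ matrix $$F_0(s)=\begin{pmatrix} s-\lambda_0&\lambda_0&0&\ldots&0\\ 0&s-\lambda_0&\lambda_0&\ldots&0\\ &&\ldots&&\\ \lambda_0 e^{-sd}&0&0&\ldots&s-\lambda_0 \end{pmatrix}$$ for $n\ge 2$ (diagonal entries $s-\lambda_0$, entries $\lambda_0$ directly above the diagonal, entry $\lambda_0e^{-sd}$ in position $(n,1)$, and $0$ elsewhere), and $F_0(s)=s-\lambda_0+\lambda_0e^{-sd}$ for $n=1$. Then the $ij$th element of the scale function $W_0(x)$ of the Markov additive process with $n$ phases characterized by $F_0(s)$ is, for $x\ge 0$, given by $$W_0(x)_{ij}=\sum_{k=1_{\{i>j\}}}^{\lfloor x/d\rfloor} g(\lambda_0(x-dk),\,kn+j-i),\qquad i,j=1,\ldots,n,$$ where $g(y,m)=\frac{(-y)^m}{m!}e^{y}$.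
   Context: A Markov additive process $(X_t,J_t)$ without positive jumps and with phases $\{1,\ldots,n\}$ is characterized by a matrix-valued function $F(s)$, $s\ge 0$, satisfying $\mathbb{E}(e^{sX_t}1_{\{J_t=j\}}\mid J_0=i)=(e^{F(s)t})_{ij}$ for all $t\ge0$ and all $i,j$. Its scale function $W_0(x)$, $x\ge 0$, is the (unique) continuous $n\times n$ matrix-valued function with $\int_0^\infty e^{-sx}W_0(x)\,dx=F(s)^{-1}$ for all sufficiently large $s$ (here with $F=F_0$). The lower summation limit $1_{\{i>j\}}$ equals $1$ if $i>j$ and $0$ otherwise; an empty sum is $0$; and $0^0=1$, so $g(0,0)=1$. *)

theory Defs
  imports "HOL-Probability.Probability" "Jordan_Normal_Form.Matrix"
begin

text \<open>
  Phases are the natural numbers \<open>1, ..., n\<close>. Library matrices are indexed from 0, so the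
  entry in row \<open>i\<close> and column \<open>j\<close> of the mathematical text is \<open>A $$ (i - 1, j - 1)\<close>.
\<close>

definition mat_exp :: "real mat \<Rightarrow> real mat" where
  "mat_exp A = mat (dim_row A) (dim_row A) (\<lambda>(i, j). \<Sum>k. (A ^\<^sub>m k) $$ (i, j) / fact k)"

text \<open>The sigma-algebra generated by the pairs \<open>(X\<^sub>u, J\<^sub>u)\<close>, \<open>0 \<le> u \<le> t\<close>, on a sample space \<open>\<Omega>\<close>.\<close>

definition history ::
  "'a set \<Rightarrow> (real \<Rightarrow> 'a \<Rightarrow> real) \<Rightarrow> (real \<Rightarrow> 'a \<Rightarrow> nat) \<Rightarrow> real \<Rightarrow> 'a set set" where
  "history \<Omega> X J t = sigma_sets \<Omega>
     ({X u -` B \<inter> \<Omega> | u B. 0 \<le> u \<and> u \<le> t \<and> B \<in> sets borel} \<union>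
      {J u -` B \<inter> \<Omega> | u B. 0 \<le> u \<and> u \<le> t})"

text \<open>
  \<open>P i\<close> is the law of the process given \<open>J\<^sub>0 = i\<close> (and \<open>X\<^sub>0 = 0\<close>). The last assumption says that,
  given the history up to time \<open>t\<close> and \<open>J\<^sub>t = j\<close>, the pair \<open>(X\<^sub>t\<^sub>+\<^sub>u - X\<^sub>t, J\<^sub>t\<^sub>+\<^sub>u)\<close> is independent
  of the history and has the law of \<open>(X\<^sub>u, J\<^sub>u)\<close> under \<open>P j\<close>.
\<close>

locale markov_additive_process =
  fixes n :: nat
    and P :: "nat \<Rightarrow> 'a measure"
    and X :: "real \<Rightarrow> 'a \<Rightarrow> real"
    and J :: "real \<Rightarrow> 'a \<Rightarrow> nat"
  assumes prob: "i \<in> {1..n} \<Longrightarrow> prob_space (P i)"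
    and same_sets: "i \<in> {1..n} \<Longrightarrow> j \<in> {1..n} \<Longrightarrow> sets (P i) = sets (P j)"
    and X_measurable: "i \<in> {1..n} \<Longrightarrow> 0 \<le> t \<Longrightarrow> X t \<in> borel_measurable (P i)"
    and J_measurable: "i \<in> {1..n} \<Longrightarrow> 0 \<le> t \<Longrightarrow> J t \<in> measurable (P i) (count_space {1..n})"
    and start: "i \<in> {1..n} \<Longrightarrow> AE \<omega> in P i. X 0 \<omega> = 0 \<and> J 0 \<omega> = i"
    and X_right_continuous: "i \<in> {1..n} \<Longrightarrow>
      AE \<omega> in P i. \<forall>t\<ge>0. ((\<lambda>u. X u \<omega>) \<longlongrightarrow> X t \<omega>) (at_right t)"
    and X_left_limits: "i \<in> {1..n} \<Longrightarrow>
      AE \<omega> in P i. \<forall>t>0. \<exists>l. ((\<lambda>u. X u \<omega>) \<longlongrightarrow> l) (at_left t)"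
    and J_right_continuous: "i \<in> {1..n} \<Longrightarrow>
      AE \<omega> in P i. \<forall>t\<ge>0. \<forall>\<^sub>F u in at_right t. J u \<omega> = J t \<omega>"
    and J_left_limits: "i \<in> {1..n} \<Longrightarrow>
      AE \<omega> in P i. \<forall>t>0. \<exists>j. \<forall>\<^sub>F u in at_left t. J u \<omega> = j"
    and markov_additive:
      "\<lbrakk>i \<in> {1..n}; j \<in> {1..n}; k \<in> {1..n}; 0 \<le> t; 0 \<le> u;
        A \<in> history (space (P i)) X J t; B \<in> sets borel\<rbrakk> \<Longrightarrow>
       measure (P i) {\<omega> \<in> A. J t \<omega> = j \<and> X (t + u) \<omega> - X t \<omega> \<in> B \<and> J (t + u) \<omega> = k}
       = measure (P i) {\<omega> \<in> A. J t \<omega> = j}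
         * measure (P j) {\<omega> \<in> space (P j). X u \<omega> \<in> B \<and> J u \<omega> = k}"

definition no_positive_jumps ::
  "nat \<Rightarrow> (nat \<Rightarrow> 'a measure) \<Rightarrow> (real \<Rightarrow> 'a \<Rightarrow> real) \<Rightarrow> bool" where
  "no_positive_jumps n P X \<longleftrightarrow>
     (\<forall>i\<in>{1..n}. AE \<omega> in P i. \<forall>t>0. \<forall>l. ((\<lambda>u. X u \<omega>) \<longlongrightarrow> l) (at_left t) \<longrightarrow> X t \<omega> \<le> l)"

definition characterized_by ::
  "nat \<Rightarrow> (nat \<Rightarrow> 'a measure) \<Rightarrow> (real \<Rightarrow> 'a \<Rightarrow> real) \<Rightarrow> (real \<Rightarrow> 'a \<Rightarrow> nat) \<Rightarrow>
   (real \<Rightarrow> real mat) \<Rightarrow> bool" where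
  "characterized_by n P X J F \<longleftrightarrow>
     (\<forall>s\<ge>0. F s \<in> carrier_mat n n) \<and>
     (\<forall>s\<ge>0. \<forall>t\<ge>0. \<forall>i\<in>{1..n}. \<forall>j\<in>{1..n}.
        has_bochner_integral (P i) (\<lambda>\<omega>. exp (s * X t \<omega>) * of_bool (J t \<omega> = j))
          (mat_exp (t \<cdot>\<^sub>m F s) $$ (i - 1, j - 1)))"

text \<open>
  Only the values of \<open>W\<close> on \<open>[0, \<infinity>)\<close> matter. The matrix \<open>G\<close> below is \<open>F(s)\<^sup>-\<^sup>1\<close>.
\<close>

definition is_scale_function :: "nat \<Rightarrow> (real \<Rightarrow> real mat) \<Rightarrow> (real \<Rightarrow> real mat) \<Rightarrow> bool" where
  "is_scale_function n F W \<longleftrightarrow>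
     (\<forall>x\<ge>0. W x \<in> carrier_mat n n) \<and>
     (\<forall>i<n. \<forall>j<n. continuous_on {0..} (\<lambda>x. W x $$ (i, j))) \<and>
     (\<forall>\<^sub>F s in at_top. \<exists>G\<in>carrier_mat n n. inverts_mat (F s) G \<and> inverts_mat G (F s) \<and>
        (\<forall>i<n. \<forall>j<n.
           set_integrable lborel {0..} (\<lambda>x. exp (- s * x) * W x $$ (i, j)) \<and>
           (LBINT x:{0..}. exp (- s * x) * W x $$ (i, j)) = G $$ (i, j)))"

definition is_scale_function_of_MAP ::
  "nat \<Rightarrow> (nat \<Rightarrow> 'a measure) \<Rightarrow> (real \<Rightarrow> 'a \<Rightarrow> real) \<Rightarrow> (real \<Rightarrow> 'a \<Rightarrow> nat) \<Rightarrow>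
   (real \<Rightarrow> real mat) \<Rightarrow> bool" where
  "is_scale_function_of_MAP n P X J W \<longleftrightarrow>
     (\<exists>F. characterized_by n P X J F \<and> is_scale_function n F W)"

definition F0 :: "nat \<Rightarrow> real \<Rightarrow> real \<Rightarrow> real \<Rightarrow> real mat" where
  "F0 n lam d s =
     (if n = 1 then mat 1 1 (\<lambda>_. s - lam + lam * exp (- s * d))
      else mat n n (\<lambda>(i, j).
        if i = j then s - lam
        else if j = i + 1 then lam
        else if i = n - 1 \<and> j = 0 then lam * exp (- s * d)
        else 0))"

definition g :: "real \<Rightarrow> nat \<Rightarrow> real" where
  "g y m = (- y) ^ m / fact m * exp y"

end

theory Submission
  imports Defs "Jordan_Normal_Form.Determinant"
begin

text \<open>
  The Laplace transform determines a continuous function on \<open>[0, \<infinity>)\<close>, so there is at most one scale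
  function (\<open>is_scale_function_unique\<close>), and it suffices to check that the explicit matrix has the
  transform \<open>F\<^sub>0(s)\<^sup>-\<^sup>1\<close>.

  Put \<open>q = -\<lambda>\<^sub>0 / (s - \<lambda>\<^sub>0)\<close> and \<open>E = e\<^sup>-\<^sup>s\<^sup>d\<close>. Then \<open>F\<^sub>0(s) = (s - \<lambda>\<^sub>0) (I - q S)\<close>, where \<open>S\<close> is the cyclic
  shift of the phases whose step from \<open>n\<close> to \<open>1\<close> has weight \<open>E\<close>. As \<open>S\<^sup>n = E I\<close>, the Neumann series
  of \<open>(I - q S)\<^sup>-\<^sup>1\<close> is a geometric series with ratio \<open>E q\<^sup>n\<close>: the \<open>(i, j)\<close> entry of \<open>F\<^sub>0(s)\<^sup>-\<^sup>1\<close> is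
  the sum of \<open>E\<^sup>k q\<^bsup>kn+j-i\<^esup> / (s - \<lambda>\<^sub>0)\<close> over the possible numbers \<open>k\<close> of passages from phase \<open>n\<close> to
  phase \<open>1\<close> on the way from \<open>i\<close> to \<open>j\<close>, and \<open>k\<close> starts at \<open>1\<close> when \<open>i > j\<close>, because \<open>j\<close> can then be
  reached only through such a passage. That the summed geometric series inverts \<open>F\<^sub>0(s)\<close> is verified
  directly (\<open>F0_mult_F0_inv\<close>). Each term \<open>E\<^sup>k q\<^sup>m / (s - \<lambda>\<^sub>0)\<close> is the transform of
  \<open>x \<mapsto> g(\<lambda>\<^sub>0 (x - dk), m)\<close> cut off below \<open>dk\<close>, which up to a constant is \<open>e\<^sup>s\<^sup>x\<close> times a
  shifted Erlang density of rate \<open>s - \<lambda>\<^sub>0\<close>;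
  for \<open>s > 2 \<lambda>\<^sub>0\<close> the series converges absolutely and may be integrated term by term
  (\<open>has_bochner_integral_laplace_scale_entry\<close>). At each \<open>x\<close> the cut-off leaves the terms with
  \<open>k \<le> \<lfloor>x / d\<rfloor>\<close>, which is the asserted sum.

  For the statement about a Markov additive process it remains to see that the process determines \<open>F\<close>:
  the matrices \<open>e\<^bsup>t F(s)\<^esup>\<close>, \<open>t \<ge> 0\<close>, are given by expectations, and \<open>F(s)\<close> is their derivative
  at \<open>t = 0\<close> (\<open>characterized_by_unique\<close>).
\<close>

section \<open>Uniqueness of Laplace transforms\<close>

text \<open>
  The hypothesis says that \<open>h\<close> is orthogonal to all polynomials in \<open>e\<^sup>-\<^sup>x\<close>. As \<open>x\<close> runs through
  \<open>[0, \<infinity>)\<close>, \<open>e\<^sup>-\<^sup>x\<close> stays in \<open>[0, 1]\<close>, where polynomials approximate \<open>\<phi>\<close> uniformly; an error \<open>\<epsilon>\<close> in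
  the weight changes the integral by at most \<open>\<epsilon>\<close> times the \<open>L\<^sup>1\<close> norm of \<open>h\<close>.
\<close>

lemma integral_continuous_of_exp_eq_0:
  fixes h \<phi> :: "real \<Rightarrow> real"
  assumes h: "set_integrable lborel {0..} h"
    and moments: "\<And>k::nat. (LBINT x:{0..}. exp (- x) ^ k * h x) = 0"
    and \<phi>: "continuous_on UNIV \<phi>"
  shows "set_integrable lborel {0..} (\<lambda>x. \<phi> (exp (- x)) * h x)"
    and "(LBINT x:{0..}. \<phi> (exp (- x)) * h x) = 0"
proof -
  define H where "H x = indicator {0..} x * h x" for x
  have H: "integrable lborel H"
    using h unfolding set_integrable_def H_def by simp
  have H_meas [measurable]: "H \<in> borel_measurable lborel"
    using H by blast
  have weighted: "integrable lborel (\<lambda>x. \<psi> (exp (- x)) * H x)"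
    if \<psi>: "continuous_on UNIV \<psi>" for \<psi> :: "real \<Rightarrow> real"
  proof -
    have [measurable]: "\<psi> \<in> borel_measurable borel"
      by (rule borel_measurable_continuous_onI[OF \<psi>])
    have "compact (\<psi> ` {0..1})"
      by (intro compact_continuous_image continuous_on_subset[OF \<psi>]) auto
    then obtain M where M: "\<And>u. 0 \<le> u \<Longrightarrow> u \<le> 1 \<Longrightarrow> \<bar>\<psi> u\<bar> \<le> M"
      using compact_imp_bounded[of "\<psi> ` {0..1}"] by (force simp: bounded_iff)
    show ?thesis
    proof (rule Bochner_Integration.integrable_bound[where f = "\<lambda>x. M * H x"])
      show "AE x in lborel. norm (\<psi> (exp (- x)) * H x) \<le> norm (M * H x)"
      proof (rule AE_I2)
        fix x :: real
        show "norm (\<psi> (exp (- x)) * H x) \<le> norm (M * H x)"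
        proof (cases "x \<ge> 0")
          case True
          then have "\<bar>\<psi> (exp (- x))\<bar> \<le> \<bar>M\<bar>"
            using M[of "exp (- x)"] by auto
          then show ?thesis by (simp add: abs_mult mult_right_mono)
        qed (simp add: H_def)
      qed
    qed (use H in auto)
  qed
  show "set_integrable lborel {0..} (\<lambda>x. \<phi> (exp (- x)) * h x)"
    using weighted[OF \<phi>] unfolding set_integrable_def H_def by (simp add: mult.left_commute)
  have small: "\<bar>\<integral>x. \<phi> (exp (- x)) * H x \<partial>lborel\<bar> \<le> 0 + e * (\<integral>x. \<bar>H x\<bar> \<partial>lborel)"
    if "e > 0" for e
  proof -
    obtain p where p: "real_polynomial_function p" "\<And>u. u \<in> {0..1} \<Longrightarrow> \<bar>\<phi> u - p u\<bar> < e"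
      using Stone_Weierstrass_real_polynomial_function[of "{0..1}" \<phi> e]
        continuous_on_subset[OF \<phi>] \<open>e > 0\<close> by auto
    obtain a N where poly: "p = (\<lambda>u. \<Sum>k\<le>N. a k * u ^ k)"
      using real_polynomial_function_imp_sum[OF p(1)] by (auto simp: fun_eq_iff)
    have p_cont: "continuous_on UNIV p"
      unfolding poly by (intro continuous_intros)
    have pow_int: "integrable lborel (\<lambda>x. exp (- x) ^ k * H x)" for k
      by (rule weighted[of "\<lambda>u. u ^ k"]) (intro continuous_intros)
    have pow_0: "(\<integral>x. exp (- x) ^ k * H x \<partial>lborel) = 0" for k
      using moments[of k] unfolding set_lebesgue_integral_def H_def by (simp add: mult.left_commute)
    have "(\<integral>x. p (exp (- x)) * H x \<partial>lborel)
        = (\<integral>x. (\<Sum>k\<le>N. a k * (exp (- x) ^ k * H x)) \<partial>lborel)"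
      by (simp add: poly sum_distrib_right mult.assoc)
    also have "\<dots> = (\<Sum>k\<le>N. a k * (\<integral>x. exp (- x) ^ k * H x \<partial>lborel))"
      by (subst Bochner_Integration.integral_sum) (auto intro!: integrable_mult_right pow_int
          simp del: exp_minus)
    finally have p_0: "(\<integral>x. p (exp (- x)) * H x \<partial>lborel) = 0"
      using pow_0 by simp
    have diff: "integrable lborel (\<lambda>x. \<phi> (exp (- x)) * H x - p (exp (- x)) * H x)"
      by (intro Bochner_Integration.integrable_diff weighted \<phi> p_cont)
    have "(\<integral>x. \<phi> (exp (- x)) * H x \<partial>lborel)
        = (\<integral>x. \<phi> (exp (- x)) * H x - p (exp (- x)) * H x \<partial>lborel)"
      using Bochner_Integration.integral_diff[OF weighted[OF \<phi>] weighted[OF p_cont]] p_0 by simp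
    also have "\<bar>\<dots>\<bar> \<le> (\<integral>x. \<bar>\<phi> (exp (- x)) * H x - p (exp (- x)) * H x\<bar> \<partial>lborel)"
      by (rule integral_abs_bound)
    also have "\<dots> \<le> (\<integral>x. e * \<bar>H x\<bar> \<partial>lborel)"
    proof (rule integral_mono)
      fix x :: real
      show "\<bar>\<phi> (exp (- x)) * H x - p (exp (- x)) * H x\<bar> \<le> e * \<bar>H x\<bar>"
      proof (cases "x \<ge> 0")
        case True
        then have "\<bar>\<phi> (exp (- x)) - p (exp (- x))\<bar> \<le> e"
          using p(2)[of "exp (- x)"] by auto
        then show ?thesis
          by (simp add: abs_mult mult_right_mono flip: left_diff_distrib)
      qed (simp add: H_def)
    qed (use diff H in auto)
    finally show ?thesis by simp
  qed
  have "(\<integral>x. \<phi> (exp (- x)) * H x \<partial>lborel) = 0"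
  proof -
    define C where "C = (\<integral>x. \<bar>H x\<bar> \<partial>lborel)"
    have C: "C \<ge> 0" unfolding C_def by simp
    have "\<bar>\<integral>x. \<phi> (exp (- x)) * H x \<partial>lborel\<bar> \<le> 0"
    proof (rule field_le_epsilon)
      fix e :: real assume "e > 0"
      \<comment> \<open>dividing by \<open>C + 1\<close> covers the case \<open>C = 0\<close>\<close>
      have "\<bar>\<integral>x. \<phi> (exp (- x)) * H x \<partial>lborel\<bar> \<le> 0 + e / (C + 1) * C"
        using small[of "e / (C + 1)"] C \<open>e > 0\<close> unfolding C_def by simp
      also have "\<dots> \<le> 0 + e"
        using C \<open>e > 0\<close> by (simp add: field_simps)
      finally show "\<bar>\<integral>x. \<phi> (exp (- x)) * H x \<partial>lborel\<bar> \<le> 0 + e" .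
    qed
    then show ?thesis by simp
  qed
  then show "(LBINT x:{0..}. \<phi> (exp (- x)) * h x) = 0"
    unfolding set_lebesgue_integral_def H_def by (simp add: mult.left_commute)
qed

text \<open>
  If \<open>h y \<noteq> 0\<close>, then \<open>h\<close> keeps its sign near \<open>y\<close>, and integrating it against a tent function of
  \<open>e\<^sup>-\<^sup>x\<close> concentrated near \<open>e\<^sup>-\<^sup>y\<close> cannot give \<open>0\<close>.
\<close>

lemma continuous_vanishing_exp_moments_imp_0:
  fixes h :: "real \<Rightarrow> real"
  assumes cont: "continuous_on {0..} h"
    and h: "set_integrable lborel {0..} h"
    and moments: "\<And>k::nat. (LBINT x:{0..}. exp (- x) ^ k * h x) = 0"
    and "x \<ge> 0"
  shows "h x = 0"
proof -
  have pos: "h y = 0" if "y > 0" for y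
  proof (rule ccontr)
    assume nz: "h y \<noteq> 0"
    define u where "u = exp (- y)"
    have "isCont h y"
      using cont \<open>y > 0\<close> by (intro continuous_on_interior[OF cont]) (simp add: interior_Ici[of "-1"])
    then have "isCont (\<lambda>v. h (- ln v)) u"
      by (intro isCont_o2[where g = h and f = "\<lambda>v. - ln v"])
        (auto simp: u_def intro!: continuous_intros)
    then have "isCont (\<lambda>v. h (- ln v) * h y) u"
      by (intro continuous_intros)
    then have "((\<lambda>v. h (- ln v) * h y) \<longlongrightarrow> h y * h y) (nhds u)"
      using tendsto_at_iff_tendsto_nhds[of "\<lambda>v. h (- ln v) * h y" u]
      unfolding isCont_def by (simp add: u_def)
    moreover have "0 < h y * h y"
      using nz by (simp add: zero_less_mult_iff) linarith
    ultimately have "\<forall>\<^sub>F v in nhds u. 0 < h (- ln v) * h y"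
      by (rule order_tendstoD(1))
    then obtain e where e: "e > 0" "\<And>v. \<bar>v - u\<bar> < e \<Longrightarrow> 0 < h (- ln v) * h y"
      by (auto simp: eventually_nhds_metric dist_real_def)
    define \<phi> where "\<phi> v = max 0 (e - \<bar>v - u\<bar>)" for v
    \<comment> \<open>the factor \<open>h y\<close> makes \<open>w\<close> nonnegative for either sign of \<open>h y\<close>\<close>
    define w where "w x = indicator {0..} x * (\<phi> (exp (- x)) * h x) * h y" for x
    have \<phi>: "continuous_on UNIV \<phi>"
      unfolding \<phi>_def by (intro continuous_intros)
    note bump = integral_continuous_of_exp_eq_0[OF h moments \<phi>]
    have w_int: "integrable lborel w"
      using bump(1) unfolding w_def set_integrable_def by simp
    have w_0: "integral\<^sup>L lborel w = 0"
      using bump(2) unfolding w_def set_lebesgue_integral_def by simp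
    have w_pos: "0 < w x" if "x \<ge> 0" "\<bar>exp (- x) - u\<bar> < e" for x
      using that e(2)[of "exp (- x)"] by (simp add: w_def \<phi>_def mult.assoc)
    have w_nonneg: "0 \<le> w x" for x
      using w_pos[of x] by (cases "x \<ge> 0 \<and> \<bar>exp (- x) - u\<bar> < e") (auto simp: w_def \<phi>_def)
    have "AE x in lborel. w x = 0"
      using integral_nonneg_eq_0_iff_AE[OF w_int] w_0 w_nonneg by simp
    then have ae: "AE x in lebesgue. w x = 0"
      by (rule AE_completion)
    define S where "S = {0<..} \<inter> {x. \<bar>exp (- x) - u\<bar> < e}"
    have "open S"
      unfolding S_def by (intro open_Int open_Collect_less continuous_intros)
    moreover have "AE x\<in>S in lebesgue. x \<in> {}"
      using ae
    proof eventually_elim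
      case (elim x)
      show ?case
      proof
        assume "x \<in> S"
        then have "0 < w x" by (intro w_pos) (auto simp: S_def)
        with elim show "x \<in> {}" by simp
      qed
    qed
    moreover have "y \<in> S"
      using \<open>y > 0\<close> e(1) by (simp add: S_def u_def)
    ultimately have "y \<in> {}"
      by (intro mem_closed_if_AE_lebesgue_open[of S "{}"]) auto
    then show False by simp
  qed
  \<comment> \<open>the boundary point \<open>0\<close> is reached by continuity\<close>
  have "closure {0<..} = {0::real..}" by simp
  then show ?thesis
    using continuous_constant_on_closure[of "{0<..}" h 0 x] cont pos \<open>x \<ge> 0\<close> by simp
qed

text \<open>
  Equality at the points \<open>s\<^sub>0, s\<^sub>0 + 1, s\<^sub>0 + 2, \<dots>\<close> is enough: there the transforms are the moments, with
  respect to \<open>e\<^sup>-\<^sup>x\<close>, of the integrable functions \<open>e\<^bsup>-s\<^sub>0x\<^esup> f\<^sub>1(x)\<close> and \<open>e\<^bsup>-s\<^sub>0x\<^esup> f\<^sub>2(x)\<close>.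
\<close>

lemma laplace_transform_unique:
  fixes f1 f2 :: "real \<Rightarrow> real"
  assumes cont: "continuous_on {0..} f1" "continuous_on {0..} f2"
    and int: "\<And>s. s \<ge> s0 \<Longrightarrow> set_integrable lborel {0..} (\<lambda>x. exp (- s * x) * f1 x)"
      "\<And>s. s \<ge> s0 \<Longrightarrow> set_integrable lborel {0..} (\<lambda>x. exp (- s * x) * f2 x)"
    and eq: "\<And>s. s \<ge> s0 \<Longrightarrow>
      (LBINT x:{0..}. exp (- s * x) * f1 x) = (LBINT x:{0..}. exp (- s * x) * f2 x)"
    and "x \<ge> 0"
  shows "f1 x = f2 x"
proof -
  define h where "h x = exp (- s0 * x) * f1 x - exp (- s0 * x) * f2 x" for x
  have "h x = 0"
  proof (rule continuous_vanishing_exp_moments_imp_0[where h = h])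
    show "continuous_on {0..} h"
      unfolding h_def by (intro continuous_intros cont)
    show "set_integrable lborel {0..} h"
      unfolding h_def[abs_def] by (intro set_integral_diff int) auto
    fix k :: nat
    have "exp (- x) ^ k * h x
        = exp (- (s0 + k) * x) * f1 x - exp (- (s0 + k) * x) * f2 x" for x
      by (simp add: h_def algebra_simps flip: exp_of_nat_mult exp_add)
    then show "(LBINT x:{0..}. exp (- x) ^ k * h x) = 0"
      using set_integral_diff(2)[OF int(1)[of "s0 + k"] int(2)[of "s0 + k"]] eq[of "s0 + k"]
      by simp
  qed fact
  then show ?thesis by (simp add: h_def)
qed

section \<open>A matrix is determined by its exponential semigroup\<close>

lemma index_mult_mat_sum:
  assumes "A \<in> carrier_mat n m" "B \<in> carrier_mat m p" "i < n" "j < p"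
  shows "(A * B) $$ (i, j) = (\<Sum>k<m. A $$ (i, k) * B $$ (k, j))"
  using assms by (auto simp: scalar_prod_def lessThan_atLeast0 intro!: sum.cong)

lemma smult_pow_mat:
  fixes A :: "'a :: comm_ring_1 mat"
  assumes A: "A \<in> carrier_mat n n"
  shows "(c \<cdot>\<^sub>m A) ^\<^sub>m k = c ^ k \<cdot>\<^sub>m A ^\<^sub>m k"
proof (induction k)
  case (Suc k)
  have "c ^ k \<cdot>\<^sub>m A ^\<^sub>m k * (c \<cdot>\<^sub>m A) = c ^ Suc k \<cdot>\<^sub>m (A ^\<^sub>m k * A)"
    using A by (intro eq_matI) (auto simp: mult_ac)
  then show ?case by (simp add: Suc.IH)
qed (use A in auto)

lemma abs_pow_mat_le:
  fixes A :: "real mat"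
  assumes A: "A \<in> carrier_mat n n"
    and M: "\<And>i j. i < n \<Longrightarrow> j < n \<Longrightarrow> \<bar>A $$ (i, j)\<bar> \<le> M"
    and "i < n" "j < n"
  shows "\<bar>(A ^\<^sub>m k) $$ (i, j)\<bar> \<le> (n * M) ^ k"
  using \<open>j < n\<close>
proof (induction k arbitrary: j)
  case 0
  then show ?case using A \<open>i < n\<close> by auto
next
  case (Suc k)
  have "(A ^\<^sub>m Suc k) $$ (i, j) = (\<Sum>l<n. (A ^\<^sub>m k) $$ (i, l) * A $$ (l, j))"
    using index_mult_mat_sum[of "A ^\<^sub>m k" n n A n i j] A \<open>i < n\<close> Suc.prems by simp
  also have "\<bar>\<dots>\<bar> \<le> (\<Sum>l<n. \<bar>(A ^\<^sub>m k) $$ (i, l) * A $$ (l, j)\<bar>)"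
    by (rule sum_abs)
  also have "\<dots> \<le> (\<Sum>l<n. (n * M) ^ k * M)"
  proof (rule sum_mono)
    fix l assume "l \<in> {..<n}"
    then have "l < n" by simp
    show "\<bar>(A ^\<^sub>m k) $$ (i, l) * A $$ (l, j)\<bar> \<le> (n * M) ^ k * M"
      unfolding abs_mult
      using Suc.IH[OF \<open>l < n\<close>] M[OF \<open>l < n\<close> Suc.prems]
      by (intro mult_mono) auto
  qed
  also have "\<dots> = (n * M) ^ Suc k"
    by (simp add: mult_ac)
  finally show ?case .
qed

text \<open>
  Each entry of \<open>e\<^bsup>tA\<^esup>\<close> is an everywhere convergent power series in \<open>t\<close>, and its linear coefficient is
  the entry of \<open>A\<close>.
\<close>

lemma DERIV_mat_exp_0:
  assumes A: "A \<in> carrier_mat n n" and ij: "i < n" "j < n"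
  shows "((\<lambda>t. mat_exp (t \<cdot>\<^sub>m A) $$ (i, j)) has_real_derivative A $$ (i, j)) (at 0)"
proof -
  define c where "c k = (A ^\<^sub>m k) $$ (i, j) / fact k" for k
  have expand: "mat_exp (t \<cdot>\<^sub>m A) $$ (i, j) = (\<Sum>k. c k * t ^ k)" for t
    using A ij by (simp add: mat_exp_def smult_pow_mat[OF A] c_def pow_mat_dim mult.commute)
  define M where "M = Max ((\<lambda>(i, j). \<bar>A $$ (i, j)\<bar>) ` ({..<n} \<times> {..<n}))"
  have M: "\<bar>A $$ (i, j)\<bar> \<le> M" if "i < n" "j < n" for i j
    unfolding M_def using that by (intro Max_ge) auto
  have "summable (\<lambda>k. c k * t ^ k)" for t
  proof (rule summable_comparison_test')
    show "summable (\<lambda>k. inverse (fact k) * (n * M * \<bar>t\<bar>) ^ k)"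
      by (rule summable_exp)
    fix k
    have "\<bar>c k * t ^ k\<bar> = inverse (fact k) * (\<bar>(A ^\<^sub>m k) $$ (i, j)\<bar> * \<bar>t\<bar> ^ k)"
      by (simp add: c_def abs_mult power_abs divide_inverse)
    also have "\<dots> \<le> inverse (fact k) * ((n * M) ^ k * \<bar>t\<bar> ^ k)"
      by (intro mult_left_mono mult_right_mono abs_pow_mat_le[OF A M ij]) auto
    finally show "norm (c k * t ^ k) \<le> inverse (fact k) * (n * M * \<bar>t\<bar>) ^ k"
      by (simp add: power_mult_distrib)
  qed
  then have "((\<lambda>t. \<Sum>k. c k * t ^ k) has_real_derivative (\<Sum>k. diffs c k * 0 ^ k)) (at 0)"
    by (rule termdiffs_strong_converges_everywhere)
  moreover have "(\<Sum>k. diffs c k * 0 ^ k) = A $$ (i, j)"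
    unfolding powser_zero using A ij by (simp add: diffs_def c_def)
  ultimately show ?thesis by (simp add: expand)
qed

text \<open>
  Agreement for \<open>t \<ge> 0\<close> suffices, because a one-sided derivative at \<open>0\<close> is already unique.
\<close>

lemma mat_exp_inj:
  assumes A: "A \<in> carrier_mat n n" and B: "B \<in> carrier_mat n n"
    and eq: "\<And>t i j. t \<ge> 0 \<Longrightarrow> i < n \<Longrightarrow> j < n \<Longrightarrow>
      mat_exp (t \<cdot>\<^sub>m A) $$ (i, j) = mat_exp (t \<cdot>\<^sub>m B) $$ (i, j)"
  shows "A = B"
proof (rule eq_matI)
  fix i j assume "i < dim_row B" "j < dim_col B"
  then have ij: "i < n" "j < n" using B by auto
  let ?D = "\<lambda>t. mat_exp (t \<cdot>\<^sub>m A) $$ (i, j) - mat_exp (t \<cdot>\<^sub>m B) $$ (i, j)"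
  have "(?D has_real_derivative A $$ (i, j) - B $$ (i, j)) (at 0)"
    by (intro derivative_intros DERIV_mat_exp_0[OF A ij] DERIV_mat_exp_0[OF B ij])
  then have "(?D has_real_derivative A $$ (i, j) - B $$ (i, j)) (at 0 within {0..})"
    by (rule has_field_derivative_at_within)
  moreover have "(?D has_real_derivative 0) (at 0 within {0..})"
    by (rule has_field_derivative_transform_within[of "\<lambda>_. 0" _ _ _ 1]) (use eq ij in auto)
  moreover have "at 0 within {0::real..} \<noteq> bot"
    by (simp add: at_within_Ici_at_right)
  ultimately have "A $$ (i, j) - B $$ (i, j) = 0"
    by (rule has_field_derivative_unique)
  then show "A $$ (i, j) = B $$ (i, j)" by simp
qed (use A B in auto)

lemma characterized_by_unique:
  assumes F: "characterized_by n P X J F" and G: "characterized_by n P X J G" and s: "s \<ge> 0"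
  shows "F s = G s"
proof (rule mat_exp_inj)
  show "F s \<in> carrier_mat n n" "G s \<in> carrier_mat n n"
    using F G s by (auto simp: characterized_by_def)
  fix t :: real and i j assume "t \<ge> 0" "i < n" "j < n"
  then have ij: "Suc i \<in> {1..n}" "Suc j \<in> {1..n}" by auto
  have transform: "has_bochner_integral (P (Suc i)) (\<lambda>\<omega>. exp (s * X t \<omega>) * of_bool (J t \<omega> = Suc j))
      (mat_exp (t \<cdot>\<^sub>m H s) $$ (Suc i - 1, Suc j - 1))" if "characterized_by n P X J H" for H
    using that s \<open>t \<ge> 0\<close> ij unfolding characterized_by_def by blast
  show "mat_exp (t \<cdot>\<^sub>m F s) $$ (i, j) = mat_exp (t \<cdot>\<^sub>m G s) $$ (i, j)"
    using has_bochner_integral_eq[OF transform[OF F] transform[OF G]] by simp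
qed

section \<open>Laplace transform of the entries of the scale matrix\<close>

text \<open>
  The exponents combine as \<open>e\<^bsup>-sx\<^esup> e\<^bsup>\<lambda>(x-a)\<^esup> = e\<^bsup>-sa\<^esup> e\<^bsup>-(s-\<lambda>)(x-a)\<^esup>\<close>. Since the Erlang density
  is nonnegative with integral \<open>1\<close>, the constant in front is the Laplace transform of the delayed
  \<open>g\<close>, and its absolute value is the \<open>L\<^sup>1\<close> norm needed to interchange sum and integral.
\<close>

lemma exp_times_delayed_g_eq_erlang:
  assumes "lam < s"
  shows "exp (- s * x) * (indicator {a..} x * g (lam * (x - a)) m)
    = exp (- s * a) * (- lam) ^ m / (s - lam) ^ Suc m * erlang_density m (s - lam) (x - a)"
proof (cases "a \<le> x")
  case True
  have "exp (- s * x) * exp (lam * (x - a)) = exp (- s * a) * exp (- (s - lam) * (x - a))"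
    by (simp add: algebra_simps flip: exp_add)
  moreover have "(- (lam * (x - a))) ^ m = (- lam) ^ m * (x - a) ^ m"
    by (simp flip: power_mult_distrib)
  ultimately have "exp (- s * x) * g (lam * (x - a)) m
      = exp (- s * a) * (- lam) ^ m * ((x - a) ^ m * exp (- (s - lam) * (x - a)) / fact m)"
    by (simp add: g_def mult_ac)
  then show ?thesis
    using True assms by (simp add: erlang_density_def)
qed (auto simp: erlang_density_def)

lemma has_bochner_integral_erlang_density:
  assumes "0 < l"
  shows "has_bochner_integral lborel (\<lambda>x. erlang_density m l (x - a)) 1"
proof -
  have "has_bochner_integral lborel (erlang_density m l) 1"
    using nn_integral_erlang_ith_moment[OF assms, of m 0] assms
    by (intro has_bochner_integral_nn_integral) auto
  then show ?thesis
    using lborel_has_bochner_integral_real_affine_iff[of 1 "erlang_density m l" 1 "- a"] by simp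
qed

definition scale_entry :: "nat \<Rightarrow> real \<Rightarrow> real \<Rightarrow> nat \<Rightarrow> nat \<Rightarrow> real \<Rightarrow> real" where
  "scale_entry n lam d i j x =
     (\<Sum>k = (if i > j then 1 else 0)..nat \<lfloor>x / d\<rfloor>. g (lam * (x - d * real k)) (k * n + j - i))"

lemma le_nat_floor_divide_iff:
  fixes x d :: real
  assumes "x \<ge> 0" "d > 0"
  shows "k \<le> nat \<lfloor>x / d\<rfloor> \<longleftrightarrow> d * real k \<le> x"
proof -
  have "k \<le> nat \<lfloor>x / d\<rfloor> \<longleftrightarrow> real k \<le> x / d"
    using assms by (simp add: le_nat_iff le_floor_iff)
  then show ?thesis
    using assms by (simp add: field_simps)
qed

text \<open>
  The upper limit \<open>\<lfloor>x / d\<rfloor>\<close> depends on \<open>x\<close>. Replacing it by the indicators of \<open>[dk, \<infinity>)\<close> gives a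
  series whose index set does not, so that it can be integrated termwise. The index \<open>l = k - k0\<close>
  starts at \<open>0\<close>, where \<open>k0\<close> is the first \<open>k\<close> with \<open>kn + j - i \<ge> 0\<close>, so that the exponents
  \<open>m0 + l n\<close> involve no truncated subtraction.
\<close>

lemma scale_entry_conv_suminf:
  fixes n :: nat and lam d x :: real
  assumes d: "d > 0" and i: "i \<le> n"
    and k0: "k0 = (if i > j then 1 else 0)" and m0: "m0 = k0 * n + j - i"
  defines "delayed \<equiv> \<lambda>l. indicator {d * real (k0 + l)..} x *
    g (lam * (x - d * real (k0 + l))) (m0 + l * n)"
  shows "finite {l. delayed l \<noteq> 0}"
    and "suminf delayed = indicator {0..} x * scale_entry n lam d i j x"
proof -
  let ?A = "{l. x \<ge> 0 \<and> k0 + l \<le> nat \<lfloor>x / d\<rfloor>}"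
  have fin: "finite ?A"
    by (rule finite_subset[of _ "{..nat \<lfloor>x / d\<rfloor>}"]) auto
  have zero: "delayed l = 0" if "l \<notin> ?A" for l
  proof (cases "x \<ge> 0")
    case True
    then have "\<not> d * real (k0 + l) \<le> x"
      using that le_nat_floor_divide_iff[OF True d, of "k0 + l"] by simp
    then show ?thesis by (simp add: delayed_def)
  next
    case False
    moreover have "0 \<le> d * real (k0 + l)" using d by simp
    ultimately show ?thesis by (simp add: delayed_def)
  qed
  show "finite {l. delayed l \<noteq> 0}"
    by (rule finite_subset[OF _ fin]) (use zero in blast)
  have "suminf delayed = (\<Sum>l\<in>?A. delayed l)"
    by (rule suminf_finite[OF fin zero])
  also have "\<dots> = indicator {0..} x * scale_entry n lam d i j x"
  proof (cases "x \<ge> 0")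
    case True
    have "(\<Sum>l\<in>?A. delayed l) = scale_entry n lam d i j x"
      unfolding scale_entry_def k0[symmetric]
    proof (rule sum.reindex_bij_witness[of _ "\<lambda>k. k - k0" "\<lambda>l. k0 + l"])
      fix l assume l: "l \<in> ?A"
      then have "d * real (k0 + l) \<le> x"
        using le_nat_floor_divide_iff[OF True d, of "k0 + l"] by simp
      moreover have "(k0 + l) * n + j - i = m0 + l * n"
        using i unfolding m0 k0 by (auto simp: algebra_simps)
      ultimately show "g (lam * (x - d * real (k0 + l))) ((k0 + l) * n + j - i) = delayed l"
        by (simp add: delayed_def)
    qed (use True in auto)
    then show ?thesis using True by simp
  qed simp
  finally show "suminf delayed = indicator {0..} x * scale_entry n lam d i j x" .
qed

text \<open>
  For \<open>s > 2\<lambda>\<close> already \<open>\<lambda> / (s - \<lambda>) < 1\<close>, so both factors of the geometric ratio are below \<open>1\<close>.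
\<close>

lemma delay_ratio_less_1:
  fixes lam d s :: real
  assumes "lam > 0" "d > 0" "s > 2 * lam" "n \<ge> 1"
  shows "\<bar>exp (- s * d) * (- lam / (s - lam)) ^ n\<bar> < 1"
proof -
  have "exp (- s * d) < 1"
    using assms by simp
  moreover have "\<bar>(- lam / (s - lam)) ^ n\<bar> \<le> 1"
    using assms by (simp add: power_abs power_le_one)
  ultimately have "exp (- s * d) * \<bar>(- lam / (s - lam)) ^ n\<bar> < 1"
    by (metis abs_ge_zero exp_ge_zero less_eq_real_def mult.right_neutral mult_left_mono order_le_less_trans)
  then show ?thesis by (simp add: abs_mult)
qed

text \<open>
  After termwise integration, term \<open>l\<close> contributes the first term times the \<open>l\<close>-th power of
  \<open>e\<^bsup>-sd\<^esup> q\<^sup>n\<close>: one more turn through the \<open>n\<close> phases costs \<open>n\<close> factors \<open>q\<close> and one delay \<open>d\<close>.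
\<close>

lemma has_bochner_integral_laplace_scale_entry:
  assumes lam: "lam > 0" and d: "d > 0" and n: "n \<ge> 1" and s: "s > 2 * lam" and i: "i \<le> n"
    and k0: "k0 = (if i > j then 1 else 0)" and m0: "m0 = k0 * n + j - i"
  shows "has_bochner_integral lborel (\<lambda>x. indicator {0..} x * (exp (- s * x) * scale_entry n lam d i j x))
    (exp (- s * d) ^ k0 * (- lam / (s - lam)) ^ m0
      / ((s - lam) * (1 - exp (- s * d) * (- lam / (s - lam)) ^ n)))"
proof -
  define q where "q = - lam / (s - lam)"
  define r where "r = exp (- s * d) * q ^ n"
  define C where "C = exp (- s * d) ^ k0 * q ^ m0 / (s - lam)"
  have r: "\<bar>r\<bar> < 1"
    unfolding r_def q_def using lam d s n by (rule delay_ratio_less_1)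
  have ls: "lam < s" "0 < s - lam"
    using s lam by auto
  let ?a = "\<lambda>l. d * real (k0 + l)"
  let ?m = "\<lambda>l. m0 + l * n"
  define f where "f l x = exp (- s * x) * (indicator {?a l..} x * g (lam * (x - ?a l)) (?m l))" for l x
  have coeff: "exp (- s * ?a l) * (- lam) ^ ?m l / (s - lam) ^ Suc (?m l) = C * r ^ l" for l
  proof -
    have "exp (- s * ?a l) = exp (- s * d) ^ (k0 + l)"
      by (simp add: mult_ac flip: exp_of_nat_mult)
    moreover have "(- lam) ^ ?m l / (s - lam) ^ Suc (?m l) = q ^ ?m l / (s - lam)"
      unfolding q_def power_divide by simp
    ultimately have "exp (- s * ?a l) * (- lam) ^ ?m l / (s - lam) ^ Suc (?m l)
        = exp (- s * d) ^ (k0 + l) * (q ^ ?m l / (s - lam))"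
      by (metis times_divide_eq_right)
    also have "\<dots> = C * r ^ l"
      by (simp add: C_def r_def power_add power_mult_distrib mult_ac flip: power_mult)
    finally show ?thesis .
  qed
  have f: "f l x = C * r ^ l * erlang_density (?m l) (s - lam) (x - ?a l)" for l x
    unfolding f_def exp_times_delayed_g_eq_erlang[OF ls(1)] coeff ..
  have f_int: "has_bochner_integral lborel (f l) (C * r ^ l)" for l
    using has_bochner_integral_mult_right[OF has_bochner_integral_erlang_density[OF ls(2)]]
    unfolding f[abs_def] by force
  have f_norm: "has_bochner_integral lborel (\<lambda>x. norm (f l x)) (\<bar>C\<bar> * \<bar>r\<bar> ^ l)" for l
  proof -
    have "norm (f l x) = \<bar>C\<bar> * \<bar>r\<bar> ^ l * erlang_density (?m l) (s - lam) (x - ?a l)" for x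
      unfolding f using ls(2) by (simp add: abs_mult power_abs)
    then show ?thesis
      using has_bochner_integral_mult_right[OF has_bochner_integral_erlang_density[OF ls(2)],
          of "\<bar>C\<bar> * \<bar>r\<bar> ^ l"] by force
  qed
  have f_int': "integrable lborel (f l)" "integral\<^sup>L lborel (f l) = C * r ^ l" for l
    using f_int[of l] by (auto simp: has_bochner_integral_iff)
  have finite_support: "finite {l. f l x \<noteq> 0}" for x
    by (rule finite_subset[OF _ scale_entry_conv_suminf(1)[OF d i k0 m0, where lam = lam and x = x]])
      (auto simp: f_def)
  have f_suminf: "(\<Sum>l. f l x) = indicator {0..} x * (exp (- s * x) * scale_entry n lam d i j x)" for x
  proof -
    have "summable (\<lambda>l. indicator {?a l..} x * g (lam * (x - ?a l)) (?m l))"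
      using scale_entry_conv_suminf(1)[OF d i k0 m0, where lam = lam and x = x] by (rule summable_finite) auto
    then show ?thesis
      using scale_entry_conv_suminf(2)[OF d i k0 m0, where lam = lam and x = x]
      by (simp add: f_def suminf_mult)
  qed
  have "summable (\<lambda>l. \<bar>C\<bar> * \<bar>r\<bar> ^ l)"
    using r by (intro summable_mult summable_geometric) simp
  then have norms: "summable (\<lambda>l. \<integral>x. norm (f l x) \<partial>lborel)"
    using f_norm by (simp add: has_bochner_integral_iff)
  have pointwise: "AE x in lborel. summable (\<lambda>l. norm (f l x))"
    by (intro AE_I2 summable_finite[OF finite_support]) auto
  have "(\<lambda>l. C * r ^ l) sums (\<integral>x. (\<Sum>l. f l x) \<partial>lborel)"
    using sums_integral[OF f_int'(1) pointwise norms] by (simp add: f_int')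
  moreover have "(\<lambda>l. C * r ^ l) sums (C * (1 / (1 - r)))"
    using r by (intro sums_mult geometric_sums) simp
  ultimately have "(\<integral>x. (\<Sum>l. f l x) \<partial>lborel) = C / (1 - r)"
    using sums_unique2 by fastforce
  then show ?thesis
    using integrable_suminf[OF f_int'(1) pointwise norms]
    unfolding has_bochner_integral_iff f_suminf C_def r_def q_def by simp
qed

section \<open>Continuity of the entries\<close>

text \<open>
  A new summand enters the sum at \<open>x = dk\<close>, \<open>k \<ge> 1\<close>, with the value \<open>g(0, kn + j - i)\<close>. This is \<open>0\<close>,
  because \<open>j - i > -n\<close> makes the exponent positive. Hence near any point the sum equals one with a
  fixed upper limit in which negative values of \<open>x - dk\<close> are replaced by \<open>0\<close>.
\<close>

lemma continuous_on_scale_entry: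
  assumes d: "d > 0" and i: "1 \<le> i" "i \<le> n" and j: "1 \<le> j" "j \<le> n"
  shows "continuous_on {0..} (scale_entry n lam d i j)"
  unfolding continuous_on_eq_continuous_within
proof
  fix x :: real assume x: "x \<in> {0..}"
  define k0 :: nat where "k0 = (if i > j then 1 else 0)"
  define N where "N = nat \<lfloor>(x + 1) / d\<rfloor>"
  define S where "S y = (\<Sum>k = k0..N. g (lam * max 0 (y - d * real k)) (k * n + j - i))" for y
  have eq: "scale_entry n lam d i j y = S y" if y: "y \<ge> 0" "y < x + 1" for y
    unfolding scale_entry_def S_def k0_def[symmetric]
  proof (rule sum.mono_neutral_cong_left)
    have "y / d \<le> (x + 1) / d"
      using y d by (intro divide_right_mono) auto
    then show "{k0..nat \<lfloor>y / d\<rfloor>} \<subseteq> {k0..N}"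
      unfolding N_def by (intro atLeastatMost_subset_iff[THEN iffD2] disjI2 conjI nat_mono floor_mono)
        auto
    show "\<forall>k\<in>{k0..N} - {k0..nat \<lfloor>y / d\<rfloor>}. g (lam * max 0 (y - d * real k)) (k * n + j - i) = 0"
    proof
      fix k assume k: "k \<in> {k0..N} - {k0..nat \<lfloor>y / d\<rfloor>}"
      then have "y < d * real k"
        using le_nat_floor_divide_iff[OF y(1) d, of k] by auto
      moreover have "k \<ge> 1"
        using k by (cases k) auto
      then have "k * n \<ge> n"
        by simp
      then have "k * n + j - i > 0"
        using i j by linarith
      ultimately show "g (lam * max 0 (y - d * real k)) (k * n + j - i) = 0"
        by (simp add: g_def)
    qed
    show "g (lam * (y - d * real k)) (k * n + j - i) = g (lam * max 0 (y - d * real k)) (k * n + j - i)"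
      if "k \<in> {k0..nat \<lfloor>y / d\<rfloor>}" for k
      using that le_nat_floor_divide_iff[OF y(1) d, of k] by simp
  qed auto
  have "isCont S x"
    unfolding S_def g_def by (intro continuous_intros) auto
  then have "continuous (at x within {0..}) S"
    by (rule continuous_at_imp_continuous_at_within)
  then show "continuous (at x within {0..}) (scale_entry n lam d i j)"
    by (rule continuous_transform_within[of _ _ _ 1]) (use x eq in \<open>auto simp: dist_real_def\<close>)
qed

section \<open>The inverse of the matrix \<open>F\<^sub>0(s)\<close>\<close>

text \<open>
  Taking the successor of a phase modulo \<open>n\<close> treats \<open>n = 1\<close>, where both contributions fall on the
  same entry, together with \<open>n \<ge> 2\<close>.
\<close>

lemma index_F0:
  assumes "n \<ge> 1" "i < n" "k < n"
  shows "F0 n lam d s $$ (i, k) = (if k = i then s - lam else 0)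
    + (if k = (i + 1) mod n then (if i = n - 1 then lam * exp (- s * d) else lam) else 0)"
proof (cases "n = 1")
  case False
  then have "(i + 1) mod n = (if i = n - 1 then 0 else i + 1)"
    using assms by auto
  then show ?thesis
    using assms False by (auto simp: F0_def)
qed (use assms in \<open>simp add: F0_def\<close>)

lemma F0_carrier [simp]: "F0 n lam d s \<in> carrier_mat n n"
  by (simp add: F0_def)

text \<open>
  The closed form of the geometric series in \<open>has_bochner_integral_laplace_scale_entry\<close>; rows and
  columns count from \<open>0\<close>, which leaves the difference of the indices unchanged.
\<close>

definition F0_inv :: "nat \<Rightarrow> real \<Rightarrow> real \<Rightarrow> real \<Rightarrow> real mat" where
  "F0_inv n lam d s = mat n n (\<lambda>(i, j).
     (let k0 = if i > j then 1 else 0 in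
      exp (- s * d) ^ k0 * (- lam / (s - lam)) ^ (k0 * n + j - i)
        / ((s - lam) * (1 - exp (- s * d) * (- lam / (s - lam)) ^ n))))"

lemma F0_inv_carrier [simp]: "F0_inv n lam d s \<in> carrier_mat n n"
  by (simp add: F0_inv_def)

text \<open>
  Up to the common factor \<open>1 / D\<close>, row \<open>i\<close> of the inverse is \<open>q\<close> times row \<open>i + 1\<close> (for the last row,
  \<open>q e\<^bsup>-sd\<^esup>\<close> times the first), except on the diagonal, where the two differ by
  \<open>1 - e\<^bsup>-sd\<^esup> q\<^sup>n\<close>. Since \<open>\<lambda> = -q (s - \<lambda>)\<close>, multiplying by row \<open>i\<close> of \<open>F\<^sub>0(s)\<close> gives
  \<open>s - \<lambda>\<close> times this difference of rows.
\<close>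

lemma F0_mult_F0_inv:
  assumes n: "n \<ge> 1" and s: "s \<noteq> lam"
    and r: "exp (- s * d) * (- lam / (s - lam)) ^ n \<noteq> 1"
  shows "F0 n lam d s * F0_inv n lam d s = 1\<^sub>m n"
proof (rule eq_matI)
  fix i j assume "i < dim_row (1\<^sub>m n :: real mat)" "j < dim_col (1\<^sub>m n :: real mat)"
  then have ij: "i < n" "j < n" by auto
  define q where "q = - lam / (s - lam)"
  define E where "E = exp (- s * d)"
  define D where "D = (s - lam) * (1 - E * q ^ n)"
  define u where "u i j = (if i > j then E * q ^ (n + j - i) else q ^ (j - i))" for i j
  have inv: "F0_inv n lam d s $$ (i, j) = u i j / D" if "i < n" for i
    using that ij by (simp add: F0_inv_def u_def D_def E_def q_def Let_def)
  have lam: "lam = - q * (s - lam)"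
    using s by (simp add: q_def)
  have D: "D \<noteq> 0"
    using s r by (simp add: D_def E_def q_def)
  let ?i' = "(i + 1) mod n" and ?c = "if i = n - 1 then E else 1"
  have shift: "u i j - q * ?c * u ?i' j = (if i = j then 1 - E * q ^ n else 0)"
  proof (cases "i = n - 1")
    case True
    then have "?i' = 0" using n by simp
    moreover have "n + j - (n - 1) = Suc j" using n by simp
    moreover have "q * q ^ (n - 1) = q ^ n"
      using n by (cases n) auto
    ultimately show ?thesis
      using True ij by (auto simp: u_def)
  next
    case False
    then have i': "?i' = Suc i" "Suc i < n" using ij by auto
    consider "j < i" | "j = i" | "j > i" by linarith
    then show ?thesis
    proof cases
      case 1
      then have "n + j - i = Suc (n + j - Suc i)" using i' by simp
      with 1 False show ?thesis unfolding i'(1) by (simp add: u_def)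
    next
      case 2
      have "q * q ^ (n - 1) = q ^ n"
        using n by (cases n) auto
      with 2 False show ?thesis unfolding i'(1) by (simp add: u_def)
    next
      case 3
      then have "j - i = Suc (j - Suc i)" by simp
      with 3 False show ?thesis unfolding i'(1) by (simp add: u_def)
    qed
  qed
  have "(F0 n lam d s * F0_inv n lam d s) $$ (i, j)
      = (\<Sum>k<n. F0 n lam d s $$ (i, k) * F0_inv n lam d s $$ (k, j))"
    by (rule index_mult_mat_sum[OF F0_carrier F0_inv_carrier ij])
  also have "\<dots> = (\<Sum>k<n. (if k = i then (s - lam) * (u k j / D) else 0)
      + (if k = ?i' then lam * ?c * (u k j / D) else 0))"
    by (intro sum.cong refl) (use n ij in \<open>simp add: index_F0 inv E_def distrib_right add_divide_distrib\<close>)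
  also have "\<dots> = (s - lam) * (u i j / D) + lam * ?c * (u ?i' j / D)"
    using n ij by (simp add: sum.distrib)
  also have "\<dots> = (s - lam) * (u i j - q * ?c * u ?i' j) / D"
  proof -
    have "a * (v / D) + (- q * a) * c * (w / D) = a * (v - q * c * w) / D" for a c v w
      by (simp add: diff_divide_distrib right_diff_distrib mult_ac)
    from this[of "s - lam"] show ?thesis unfolding lam[symmetric] .
  qed
  also have "\<dots> = 1\<^sub>m n $$ (i, j)"
    unfolding shift using D ij by (simp add: D_def)
  finally show "(F0 n lam d s * F0_inv n lam d s) $$ (i, j) = 1\<^sub>m n $$ (i, j)" .
qed (simp_all add: F0_def F0_inv_def)

section \<open>Existence and uniqueness of the scale function\<close>

lemma is_scale_function_cong:
  assumes W: "is_scale_function n F W"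
    and F: "\<forall>\<^sub>F s in at_top. F s = F' s" and eq: "\<And>x. x \<ge> 0 \<Longrightarrow> W x = W' x"
  shows "is_scale_function n F' W'"
proof -
  have int: "set_integrable lborel {0..} (\<lambda>x. exp (- s * x) * W x $$ (i, j))
      \<longleftrightarrow> set_integrable lborel {0..} (\<lambda>x. exp (- s * x) * W' x $$ (i, j))"
    "(LBINT x:{0..}. exp (- s * x) * W x $$ (i, j)) = (LBINT x:{0..}. exp (- s * x) * W' x $$ (i, j))"
    for s i j
    by (intro set_integrable_cong set_lebesgue_integral_cong; use eq in auto)+
  have cont: "continuous_on {0..} (\<lambda>x. W x $$ (i, j)) \<longleftrightarrow> continuous_on {0..} (\<lambda>x. W' x $$ (i, j))" for i j
    by (intro continuous_on_cong) (use eq in auto)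
  have laplace: "\<forall>\<^sub>F s in at_top. \<exists>G\<in>carrier_mat n n. inverts_mat (F s) G \<and> inverts_mat G (F s) \<and>
      (\<forall>i<n. \<forall>j<n. set_integrable lborel {0..} (\<lambda>x. exp (- s * x) * W' x $$ (i, j)) \<and>
        (LBINT x:{0..}. exp (- s * x) * W' x $$ (i, j)) = G $$ (i, j))"
    using W unfolding is_scale_function_def int by blast
  have "\<forall>\<^sub>F s in at_top. \<exists>G\<in>carrier_mat n n. inverts_mat (F' s) G \<and> inverts_mat G (F' s) \<and>
      (\<forall>i<n. \<forall>j<n. set_integrable lborel {0..} (\<lambda>x. exp (- s * x) * W' x $$ (i, j)) \<and>
        (LBINT x:{0..}. exp (- s * x) * W' x $$ (i, j)) = G $$ (i, j))"
    using laplace F by eventually_elim simp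
  then show ?thesis
    using W eq unfolding is_scale_function_def cont by metis
qed

lemma inverts_mat_unique:
  fixes A :: "'a :: semiring_1 mat"
  assumes carrier: "A \<in> carrier_mat n n" "B \<in> carrier_mat n n" "C \<in> carrier_mat n n"
    and "inverts_mat A B" "inverts_mat C A"
  shows "B = C"
  using assms assoc_mult_mat[OF carrier(3) carrier(1) carrier(2)]
  unfolding inverts_mat_def by auto

text \<open>
  Inverse matrices are unique, so both candidates have the same Laplace transform for large \<open>s\<close>.
\<close>

lemma is_scale_function_unique:
  assumes F: "\<forall>\<^sub>F s in at_top. F s \<in> carrier_mat n n"
    and W1: "is_scale_function n F W1" and W2: "is_scale_function n F W2" and x: "x \<ge> 0"
  shows "W1 x = W2 x"
proof (rule eq_matI)
  have carrier: "W1 x \<in> carrier_mat n n" "W2 x \<in> carrier_mat n n"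
    using W1 W2 x by (auto simp: is_scale_function_def)
  then show "dim_row (W1 x) = dim_row (W2 x)" "dim_col (W1 x) = dim_col (W2 x)" by auto
  fix i j assume "i < dim_row (W2 x)" "j < dim_col (W2 x)"
  then have ij: "i < n" "j < n" using carrier by auto
  let ?I = "\<lambda>W s. set_integrable lborel {0..} (\<lambda>x. exp (- s * x) * W x $$ (i, j))"
  let ?L = "\<lambda>W s. LBINT x:{0..}. exp (- s * x) * W x $$ (i, j)"
  have ev: "\<forall>\<^sub>F s in at_top. \<exists>G\<in>carrier_mat n n. inverts_mat (F s) G \<and> inverts_mat G (F s) \<and>
      ?I W s \<and> ?L W s = G $$ (i, j)" if "is_scale_function n F W" for W
  proof -
    have "\<forall>\<^sub>F s in at_top. \<exists>G\<in>carrier_mat n n. inverts_mat (F s) G \<and> inverts_mat G (F s) \<and>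
        (\<forall>i<n. \<forall>j<n. set_integrable lborel {0..} (\<lambda>x. exp (- s * x) * W x $$ (i, j)) \<and>
          (LBINT x:{0..}. exp (- s * x) * W x $$ (i, j)) = G $$ (i, j))"
      using that by (simp add: is_scale_function_def)
    then show ?thesis
      by eventually_elim (use ij in blast)
  qed
  have "\<forall>\<^sub>F s in at_top. ?I W1 s \<and> ?I W2 s \<and> ?L W1 s = ?L W2 s"
    using F ev[OF W1] ev[OF W2]
  proof eventually_elim
    case (elim s)
    then show ?case using inverts_mat_unique[of "F s" n] by metis
  qed
  then obtain s0 where s0: "\<And>s. s \<ge> s0 \<Longrightarrow> ?I W1 s \<and> ?I W2 s \<and> ?L W1 s = ?L W2 s"
    by (auto simp: eventually_at_top_linorder)
  show "W1 x $$ (i, j) = W2 x $$ (i, j)"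
    by (rule laplace_transform_unique[of "\<lambda>x. W1 x $$ (i, j)" "\<lambda>x. W2 x $$ (i, j)" s0])
      (use W1 W2 ij s0 x in \<open>auto simp: is_scale_function_def\<close>)
qed

definition scale_matrix :: "nat \<Rightarrow> real \<Rightarrow> real \<Rightarrow> real \<Rightarrow> real mat" where
  "scale_matrix n lam d x = mat n n (\<lambda>(i, j). scale_entry n lam d (i + 1) (j + 1) x)"

lemma eq_scale_matrix_iff:
  "A = scale_matrix n lam d x \<longleftrightarrow> A \<in> carrier_mat n n \<and>
     (\<forall>i\<in>{1..n}. \<forall>j\<in>{1..n}. A $$ (i - 1, j - 1) = scale_entry n lam d i j x)"
  (is "?L \<longleftrightarrow> ?R")
proof
  assume R: ?R
  show ?L
  proof (rule eq_matI)
    fix i j assume "i < dim_row (scale_matrix n lam d x)" "j < dim_col (scale_matrix n lam d x)"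
    then have ij: "i < n" "j < n" by (auto simp: scale_matrix_def)
    then have "Suc i \<in> {1..n}" "Suc j \<in> {1..n}" by auto
    then have "A $$ (Suc i - 1, Suc j - 1) = scale_entry n lam d (Suc i) (Suc j) x"
      using R by blast
    with ij show "A $$ (i, j) = scale_matrix n lam d x $$ (i, j)"
      by (simp add: scale_matrix_def)
  qed (use R in \<open>auto simp: scale_matrix_def\<close>)
qed (auto simp: scale_matrix_def)

lemma is_scale_function_scale_matrix:
  assumes n: "n \<ge> 1" and lam: "lam > 0" and d: "d > 0"
  shows "is_scale_function n (F0 n lam d) (scale_matrix n lam d)"
  unfolding is_scale_function_def
proof (intro conjI allI impI)
  show "scale_matrix n lam d x \<in> carrier_mat n n" for x
    by (simp add: scale_matrix_def)
  show "continuous_on {0..} (\<lambda>x. scale_matrix n lam d x $$ (i, j))" if "i < n" "j < n" for i j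
    using continuous_on_scale_entry[OF d, of "i + 1" n "j + 1" lam] that
    by (simp add: scale_matrix_def)
  show "\<forall>\<^sub>F s in at_top. \<exists>G\<in>carrier_mat n n.
      inverts_mat (F0 n lam d s) G \<and> inverts_mat G (F0 n lam d s) \<and>
      (\<forall>i<n. \<forall>j<n.
        set_integrable lborel {0..} (\<lambda>x. exp (- s * x) * scale_matrix n lam d x $$ (i, j)) \<and>
        (LBINT x:{0..}. exp (- s * x) * scale_matrix n lam d x $$ (i, j)) = G $$ (i, j))"
    using eventually_gt_at_top[of "2 * lam"]
  proof eventually_elim
    case (elim s)
    have "F0 n lam d s * F0_inv n lam d s = 1\<^sub>m n"
      using F0_mult_F0_inv[OF n, of s lam d] delay_ratio_less_1[OF lam d elim n] elim lam by fastforce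
    then have inv: "inverts_mat (F0 n lam d s) (F0_inv n lam d s)"
        "inverts_mat (F0_inv n lam d s) (F0 n lam d s)"
      using mat_mult_left_right_inverse[OF F0_carrier F0_inv_carrier]
      by (auto simp: inverts_mat_def F0_def F0_inv_def)
    have "has_bochner_integral lborel
        (\<lambda>x. indicator {0..} x *\<^sub>R (exp (- s * x) * scale_matrix n lam d x $$ (i, j)))
        (F0_inv n lam d s $$ (i, j))" if "i < n" "j < n" for i j
      using has_bochner_integral_laplace_scale_entry[OF lam d n elim, of "i + 1" _ "j + 1"] that
      by (simp add: scale_matrix_def F0_inv_def Let_def)
    then show ?case
      using inv F0_inv_carrier
      unfolding set_integrable_def set_lebesgue_integral_def has_bochner_integral_iff by blast
  qed
qed

theorem theorem2:
  fixes n :: nat and lam d :: real and W :: "real \<Rightarrow> real mat"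
    and P :: "nat \<Rightarrow> 'a measure" and X :: "real \<Rightarrow> 'a \<Rightarrow> real" and J :: "real \<Rightarrow> 'a \<Rightarrow> nat"
  assumes "n \<ge> 1" and "lam > 0" and "d > 0"
  shows "(is_scale_function n (F0 n lam d) W \<longleftrightarrow>
      (\<forall>x\<ge>0. W x \<in> carrier_mat n n \<and>
        (\<forall>i\<in>{1..n}. \<forall>j\<in>{1..n}. W x $$ (i - 1, j - 1) =
          (\<Sum>k = (if i > j then 1 else 0)..nat \<lfloor>x / d\<rfloor>.
             g (lam * (x - d * real k)) (k * n + j - i)))))
    \<and> (markov_additive_process n P X J \<and> no_positive_jumps n P X \<and>
        characterized_by n P X J (F0 n lam d) \<longrightarrow>
      (is_scale_function_of_MAP n P X J W \<longleftrightarrow>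
      (\<forall>x\<ge>0. W x \<in> carrier_mat n n \<and>
        (\<forall>i\<in>{1..n}. \<forall>j\<in>{1..n}. W x $$ (i - 1, j - 1) =
          (\<Sum>k = (if i > j then 1 else 0)..nat \<lfloor>x / d\<rfloor>.
             g (lam * (x - d * real k)) (k * n + j - i))))))"
proof -
  have scale: "is_scale_function n (F0 n lam d) W \<longleftrightarrow> (\<forall>x\<ge>0. W x = scale_matrix n lam d x)"
  proof
    assume "is_scale_function n (F0 n lam d) W"
    then show "\<forall>x\<ge>0. W x = scale_matrix n lam d x"
      using is_scale_function_unique[OF _ _ is_scale_function_scale_matrix[OF assms]] by simp
  next
    assume "\<forall>x\<ge>0. W x = scale_matrix n lam d x"
    then show "is_scale_function n (F0 n lam d) W"
      by (intro is_scale_function_cong[OF is_scale_function_scale_matrix[OF assms]]) auto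
  qed
  have map: "is_scale_function_of_MAP n P X J W \<longleftrightarrow> is_scale_function n (F0 n lam d) W"
    if F0: "characterized_by n P X J (F0 n lam d)"
  proof
    assume "is_scale_function_of_MAP n P X J W"
    then obtain F where F: "characterized_by n P X J F" "is_scale_function n F W"
      by (auto simp: is_scale_function_of_MAP_def)
    have "\<forall>\<^sub>F s in at_top. F s = F0 n lam d s"
      using eventually_ge_at_top[of 0]
      by eventually_elim (rule characterized_by_unique[OF F(1) F0])
    then show "is_scale_function n (F0 n lam d) W"
      by (rule is_scale_function_cong[OF F(2)]) simp
  qed (use F0 in \<open>auto simp: is_scale_function_of_MAP_def\<close>)
  show ?thesis
    using scale map unfolding eq_scale_matrix_iff scale_entry_def by blast
qed

end
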